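(* Let $r\ge 2$. The lifted Hamming code $H_r'$ is a $2^r$-graphical design on $Q_{2^r}$, and $H_r''$ is a $(2^r+1)$-graphical design on $Q_{2^r+1}$. Moreover $$\operatorname{efficacy}(H_r')=\frac{2^{2^r-r}}{2^{2^r}-\binom{2^r}{2^{r-1}}}\sim\frac{1}{2^r}\quad\text{and}\quad \operatorname{efficacy}(H_r'')=\frac{2^{2^r-r+1}}{2^{2^r+1}-\binom{2^r+1}{2^{r-1}}}\sim\frac{1}{2^r},$$ where $\sim$ means that the ratio tends to $1$ as $r\to\infty$.
   Context: $Q_d$ is the graph with vertex set $\{0,1\}^d$ in which two vertices are adjacent iff they differ in exactly one coordinate. For a graph $G=(V,E)$ with adjacency matrix $A$ and diagonal degree matrix $D$, $L=AD^{-1}-I$. A nonempty $W\subset V$ integrates $\phi:V\to\mathbb{R}$ if $\frac{1}{|W|}\sum_{w\in W}\phi(w)=\frac{1}{|V|}\sum_{v\in V}\phi(v)$, and integrates an eigenspace of $L$ if it integrates every eigenvector in a basis of it. For $Q_d$, the eigenspaces of $L$ are $\Lambda_i=\operatorname{span}\{\phi_v: v \text{ has exactly } i \text{ ones}\}$, $i=0,\dots,d$, where $\phi_v(x)=(-1)^{v^Tx}$, with eigenvalue $\lambda=-2i/d$ and dimension $\binom{d}{i}$. A frequency ordering lists the eigenspaces in order of nonincreasing $|\lambda+1|$, with the eigenspace $\Lambda_0$ of eigenvalue $0$ first; eigenspaces with equal $|\lambda+1|$ (namely $\Lambda_i$ and $\Lambda_{d-i}$) are interchangeable and may be placed in either order.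 $W$ is a $k$-graphical design if it integrates the first $k$ eigenspaces in some frequency ordering. The efficacy of $W$ is the minimum, over all frequency orderings and all $k$ such that $W$ integrates the first $k$ eigenspaces, of $|W|$ divided by the sum of the dimensions of these first $k$ eigenspaces. Let $M_r$ be the $r\times(2^r-1)$ matrix over the field with two elements whose columns are the nonzero vectors of $\{0,1\}^r$ (the check matrix of the Hamming code $H_r=\{x: M_rx=0\}$). $H_r'\subset\{0,1\}^{2^r}$ is the kernel (mod 2) of $M_r'=[M_r\ 0]$, obtained from $M_r$ by appending one zero column, and $H_r''\subset\{0,1\}^{2^r+1}$ is the kernel (mod 2) of $M_r''=[M_r\ 0\ 0]$, obtained by appending two zero columns. *)

theory Defs
  imports
    Complex_Main
    "HOL-Library.Function_Algebras"
    "HOL-Library.Landau_Symbols"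
    "HOL-Library.Z2"
    "Jordan_Normal_Form.Matrix_Kernel"
begin

text \<open>
  A finite graph is given by its vertex set \<open>V\<close> and its adjacency relation \<open>E\<close>.
  A function \<open>\<phi> : V \<rightarrow> \<real>\<close> is represented by the total function that agrees with it on \<open>V\<close> and
  vanishes outside \<open>V\<close>. The real vector space structure on functions is the pointwise one.
\<close>

global_interpretation fun_vs: vector_space "\<lambda>(c :: real) (f :: 'a \<Rightarrow> real) x. c * f x"
  by unfold_locales (auto simp: fun_eq_iff algebra_simps)

definition is_basis :: "('a \<Rightarrow> real) set \<Rightarrow> ('a \<Rightarrow> real) set \<Rightarrow> bool" where
  "is_basis B S \<longleftrightarrow> fun_vs.independent B \<and> fun_vs.span B = S"

definition degree_of :: "'a set \<Rightarrow> ('a \<Rightarrow> 'a \<Rightarrow> bool) \<Rightarrow> 'a \<Rightarrow> nat" where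
  "degree_of V E x = card {y \<in> V. E x y}"

text \<open>The entries of \<open>L = A D\<^sup>-\<^sup>1 - I\<close>, where \<open>A\<close> is the adjacency matrix and \<open>D\<close> the degree matrix.\<close>

definition laplacian :: "'a set \<Rightarrow> ('a \<Rightarrow> 'a \<Rightarrow> bool) \<Rightarrow> 'a \<Rightarrow> 'a \<Rightarrow> real" where
  "laplacian V E x y =
     (if E x y then 1 else 0) * (1 / real (degree_of V E y)) - (if x = y then 1 else 0)"

definition eigenspace :: "'a set \<Rightarrow> ('a \<Rightarrow> 'a \<Rightarrow> bool) \<Rightarrow> real \<Rightarrow> ('a \<Rightarrow> real) set" where
  "eigenspace V E \<theta> =
     {\<phi>. (\<forall>x. x \<notin> V \<longrightarrow> \<phi> x = 0) \<and> (\<forall>x\<in>V. (\<Sum>y\<in>V. laplacian V E x y * \<phi> y) = \<theta> * \<phi> x)}"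

definition eigenvalues :: "'a set \<Rightarrow> ('a \<Rightarrow> 'a \<Rightarrow> bool) \<Rightarrow> real set" where
  "eigenvalues V E = {\<theta>. \<exists>\<phi>\<in>eigenspace V E \<theta>. \<phi> \<noteq> 0}"

definition integrates :: "'a set \<Rightarrow> 'a set \<Rightarrow> ('a \<Rightarrow> real) \<Rightarrow> bool" where
  "integrates V W \<phi> \<longleftrightarrow>
     (\<Sum>w\<in>W. \<phi> w) / real (card W) = (\<Sum>v\<in>V. \<phi> v) / real (card V)"

definition integrates_space :: "'a set \<Rightarrow> 'a set \<Rightarrow> ('a \<Rightarrow> real) set \<Rightarrow> bool" where
  "integrates_space V W S \<longleftrightarrow> (\<exists>B. is_basis B S \<and> (\<forall>\<phi>\<in>B. integrates V W \<phi>))"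

text \<open>An ordering of the eigenspaces is encoded as the list of their (distinct) eigenvalues.\<close>

definition frequency_ordering :: "'a set \<Rightarrow> ('a \<Rightarrow> 'a \<Rightarrow> bool) \<Rightarrow> real list \<Rightarrow> bool" where
  "frequency_ordering V E ls \<longleftrightarrow>
     distinct ls \<and> set ls = eigenvalues V E \<and>
     sorted_wrt (\<lambda>\<theta> \<mu>. \<bar>\<theta> + 1\<bar> \<ge> \<bar>\<mu> + 1\<bar>) ls \<and>
     ls \<noteq> [] \<and> hd ls = 0"

definition integrates_first ::
    "'a set \<Rightarrow> ('a \<Rightarrow> 'a \<Rightarrow> bool) \<Rightarrow> 'a set \<Rightarrow> real list \<Rightarrow> nat \<Rightarrow> bool" where
  "integrates_first V E W ls k \<longleftrightarrow>
     1 \<le> k \<and> k \<le> length ls \<and> (\<forall>i<k. integrates_space V W (eigenspace V E (ls ! i)))"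

definition graphical_design ::
    "'a set \<Rightarrow> ('a \<Rightarrow> 'a \<Rightarrow> bool) \<Rightarrow> nat \<Rightarrow> 'a set \<Rightarrow> bool" where
  "graphical_design V E k W \<longleftrightarrow>
     W \<subseteq> V \<and> W \<noteq> {} \<and> (\<exists>ls. frequency_ordering V E ls \<and> integrates_first V E W ls k)"

definition efficacy :: "'a set \<Rightarrow> ('a \<Rightarrow> 'a \<Rightarrow> bool) \<Rightarrow> 'a set \<Rightarrow> real" where
  "efficacy V E W =
     Min {real (card W) / real (\<Sum>i<k. fun_vs.dim (eigenspace V E (ls ! i))) | ls k.
            frequency_ordering V E ls \<and> integrates_first V E W ls k}"

definition cube_verts :: "nat \<Rightarrow> bit vec set" where
  "cube_verts d = carrier_vec d"

definition cube_adj :: "nat \<Rightarrow> bit vec \<Rightarrow> bit vec \<Rightarrow> bool" where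
  "cube_adj d x y \<longleftrightarrow>
     x \<in> carrier_vec d \<and> y \<in> carrier_vec d \<and> card {i. i < d \<and> x $ i \<noteq> y $ i} = 1"

text \<open>The order of the columns is left open: any enumeration of the nonzero vectors is allowed.\<close>

definition hamming_check_matrix :: "nat \<Rightarrow> bit mat \<Rightarrow> bool" where
  "hamming_check_matrix r M \<longleftrightarrow>
     M \<in> carrier_mat r (2 ^ r - 1) \<and>
     bij_betw (col M) {..<2 ^ r - 1} (carrier_vec r - {0\<^sub>v r})"

definition append_zero_cols :: "nat \<Rightarrow> 'a :: zero mat \<Rightarrow> 'a mat" where
  "append_zero_cols m M =
     mat (dim_row M) (dim_col M + m) (\<lambda>(i, j). if j < dim_col M then M $$ (i, j) else 0)"

text \<open>For \<open>M = M\<^sub>r\<close>, the cases \<open>m = 1\<close> and \<open>m = 2\<close> are the codes \<open>H\<^sub>r'\<close> and \<open>H\<^sub>r''\<close>.\<close>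

definition lifted_code :: "nat \<Rightarrow> bit mat \<Rightarrow> bit vec set" where
  "lifted_code m M = mat_kernel (append_zero_cols m M)"

end

theory Submission
  imports Defs
begin

text \<open>
  Write \<open>d\<close> for the dimension and, for \<open>S \<subseteq> {..<d}\<close>, let \<open>walsh d S\<close> be the character
  \<open>x \<mapsto> (-1) ^ (\<Sum>i\<in>S. x $ i)\<close> of the cube. The characters are orthogonal, there are as many of them as
  vertices, and \<open>walsh d S\<close> is an eigenvector of the Laplacian for \<open>-2 * card S / d\<close>. Hence the
  eigenspaces are spanned by the levels \<open>card S = i\<close>, for \<open>i = 0, \<dots>, d\<close>, and have dimension
  \<open>d choose i\<close>.

  Which characters the kernel of a binary matrix integrates is decided by Poisson summation: expanding
  the indicator of the kernel in characters of the syndrome space shows that the sum of \<open>walsh d S\<close>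
  over the kernel is nonzero exactly when the indicator vector of \<open>S\<close> lies in the row space
  (\<open>sum_walsh_kernel\<close>). The columns of a Hamming check matrix are all nonzero vectors, half of all
  vectors are off any hyperplane, and zero columns add nothing, so each nonzero combination of rows of
  the padded matrix has weight \<open>2 ^ (r - 1)\<close> (\<open>card_row_support_hamming\<close>). The lifted code therefore
  integrates every eigenspace except the one of level \<open>m = 2 ^ (r - 1)\<close>
  (\<open>lifted_code_integrates_iff\<close>).

  For \<open>d = 2 ^ r\<close> and \<open>d = 2 ^ r + 1\<close> the eigenvalue of this level is as close to \<open>-1\<close> as any,
  so some frequency ordering puts it last; the code then integrates all \<open>d\<close> eigenspaces before it.
  An initial segment that is integrated cannot contain the missing eigenspace, so the largest
  sum of dimensions is \<open>2 ^ d - (d choose m)\<close> (\<open>efficacy_all_but_last\<close>). Since the code has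
  \<open>2 ^ d / 2 ^ r\<close> words, its efficacy is \<open>1 / 2 ^ r\<close> divided by \<open>1 - (d choose m) / 2 ^ d\<close>, and the
  subtracted density is a central one, \<open>((2 * k) choose k) / 4 ^ k\<close>, which tends to \<open>0\<close>.
\<close>

section \<open>Walsh functions\<close>

definition bit_sign :: "bit \<Rightarrow> real" where
  "bit_sign b = (if b = 1 then - 1 else 1)"

text \<open>
  The characters of the cube, indexed by the supports of the frequency vectors so that levels are
  counted by binomial coefficients. The value \<open>0\<close> off the cube makes them elements of the
  eigenspaces as encoded here.
\<close>

definition walsh :: "nat \<Rightarrow> nat set \<Rightarrow> bit vec \<Rightarrow> real" where
  "walsh d S x = (if x \<in> cube_verts d then \<Prod>i\<in>S. bit_sign (x $ i) else 0)"

lemma bit_sign_0 [simp]: "bit_sign 0 = 1"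
  by (simp add: bit_sign_def)

lemma bit_sign_1 [simp]: "bit_sign 1 = - 1"
  by (simp add: bit_sign_def)

lemma bit_sign_add: "bit_sign (a + b) = bit_sign a * bit_sign b"
  by (cases a; cases b) (auto simp: bit_sign_def)

lemma bit_sign_mult_self [simp]: "bit_sign a * bit_sign a = 1"
  by (simp add: bit_sign_def)

lemma bit_sign_sum: "bit_sign (sum f A) = (\<Prod>a\<in>A. bit_sign (f a))"
  by (induction A rule: infinite_finite_induct) (simp_all add: bit_sign_add del: add_bit_eq_xor)

lemma bij_betw_support_cube:
  "bij_betw (\<lambda>x. {i. i < d \<and> x $ i = 1}) (cube_verts d) (Pow {..<d})"
proof (rule bij_betwI')
  fix x y :: "bit vec"
  assume xy: "x \<in> cube_verts d" "y \<in> cube_verts d"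
  show "({i. i < d \<and> x $ i = 1} = {i. i < d \<and> y $ i = 1}) = (x = y)"
  proof
    assume eq: "{i. i < d \<and> x $ i = 1} = {i. i < d \<and> y $ i = 1}"
    show "x = y"
    proof (rule eq_vecI)
      show "dim_vec x = dim_vec y"
        using xy by (simp add: cube_verts_def)
      fix i
      assume "i < dim_vec y"
      then have "i < d"
        using xy by (simp add: cube_verts_def)
      then have "x $ i = 1 \<longleftrightarrow> y $ i = 1"
        using eq by blast
      then show "x $ i = y $ i"
        by (metis bit_not_one_iff)
    qed
  qed simp
next
  fix S
  assume "S \<in> Pow {..<d}"
  then have "S = {i. i < d \<and> vec d (\<lambda>i. if i \<in> S then 1 else 0 :: bit) $ i = 1}"
    by (auto split: if_splits)
  then show "\<exists>x\<in>cube_verts d. S = {i. i < d \<and> x $ i = 1}"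
    unfolding cube_verts_def using vec_carrier by blast
qed auto

lemma finite_cube_verts [simp]: "finite (cube_verts d)"
  using bij_betw_finite[OF bij_betw_support_cube[of d]] by simp

lemma card_cube_verts: "card (cube_verts d) = 2 ^ d"
  using bij_betw_same_card[OF bij_betw_support_cube[of d]] by (simp add: card_Pow)

lemma zero_in_cube [simp]: "0\<^sub>v d \<in> cube_verts d"
  by (simp add: cube_verts_def)

lemma add_in_cube: "x \<in> cube_verts d \<Longrightarrow> y \<in> cube_verts d \<Longrightarrow> x + y \<in> cube_verts d"
  by (simp add: cube_verts_def)

lemma unit_in_cube: "unit_vec d i \<in> cube_verts d"
  by (simp add: cube_verts_def)

lemma walsh_outside: "x \<notin> cube_verts d \<Longrightarrow> walsh d S x = 0"
  by (simp add: walsh_def)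

lemma walsh_empty: "x \<in> cube_verts d \<Longrightarrow> walsh d {} x = 1"
  by (simp add: walsh_def)

lemma walsh_zero: "S \<subseteq> {..<d} \<Longrightarrow> walsh d S (0\<^sub>v d) = 1"
  by (auto simp: walsh_def intro!: prod.neutral)

text \<open>
  Over a product range that does not depend on \<open>S\<close>, Walsh functions can be multiplied factor by
  factor.
\<close>

lemma walsh_alt:
  assumes "S \<subseteq> {..<d}" "x \<in> cube_verts d"
  shows "walsh d S x = (\<Prod>i<d. if i \<in> S then bit_sign (x $ i) else 1)"
proof -
  have "{..<d} \<inter> S = S"
    using assms by auto
  then show ?thesis
    using assms by (simp add: walsh_def flip: prod.inter_restrict)
qed

lemma walsh_mult:
  assumes "S \<subseteq> {..<d}" "T \<subseteq> {..<d}"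
  shows "walsh d S x * walsh d T x = walsh d (sym_diff S T) x"
proof (cases "x \<in> cube_verts d")
  case True
  have "sym_diff S T \<subseteq> {..<d}"
    using assms by auto
  then show ?thesis
    unfolding walsh_alt[OF assms(1) True] walsh_alt[OF assms(2) True]
      walsh_alt[OF \<open>sym_diff S T \<subseteq> {..<d}\<close> True] prod.distrib[symmetric]
    by (intro prod.cong) auto
qed (simp add: walsh_outside)

lemma walsh_add:
  assumes "S \<subseteq> {..<d}" "x \<in> cube_verts d" "y \<in> cube_verts d"
  shows "walsh d S (x + y) = walsh d S x * walsh d S y"
proof -
  have "bit_sign ((x + y) $ i) = bit_sign (x $ i) * bit_sign (y $ i)" if "i \<in> S" for i
  proof -
    have "i < dim_vec y"
      using that assms by (auto simp: cube_verts_def)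
    then show ?thesis
      by (simp add: bit_sign_add del: add_bit_eq_xor)
  qed
  then show ?thesis
    using assms by (simp add: walsh_def add_in_cube prod.distrib)
qed

lemma walsh_unit:
  assumes "S \<subseteq> {..<d}" "i < d"
  shows "walsh d S (unit_vec d i) = (if i \<in> S then - 1 else 1)"
proof -
  have "finite S"
    using assms finite_subset by blast
  have "walsh d S (unit_vec d i) = (\<Prod>j\<in>S. if j = i then - 1 else 1)"
    using assms by (auto simp: walsh_def unit_in_cube intro!: prod.cong)
  then show ?thesis
    using \<open>finite S\<close> by simp
qed

lemma cube_add_self_cancel:
  assumes "x \<in> cube_verts d" "y \<in> cube_verts d"
  shows "x + y + y = x"
proof (rule eq_vecI)
  fix i
  assume "i < dim_vec x"
  then show "(x + y + y) $ i = x $ i"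
    using assms by (cases "x $ i"; cases "y $ i") (auto simp: cube_verts_def)
qed (use assms in \<open>auto simp: cube_verts_def\<close>)

lemma sum_cube_translate:
  assumes "y \<in> cube_verts d"
  shows "(\<Sum>x\<in>cube_verts d. f (x + y)) = (\<Sum>x\<in>cube_verts d. f x)"
  by (rule sum.reindex_bij_witness[of _ "\<lambda>x. x + y" "\<lambda>x. x + y"])
    (auto simp: assms cube_add_self_cancel add_in_cube)

text \<open>
  Flipping a coordinate \<open>i \<in> S\<close> permutes the cube and negates \<open>walsh d S\<close>, so a nonconstant character
  sums to \<open>0\<close>.
\<close>

lemma sum_walsh:
  assumes "S \<subseteq> {..<d}"
  shows "(\<Sum>x\<in>cube_verts d. walsh d S x) = (if S = {} then 2 ^ d else 0)"
proof (cases "S = {}")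
  case True
  then show ?thesis
    by (simp add: walsh_empty card_cube_verts)
next
  case False
  then obtain i where i: "i \<in> S" "i < d"
    using assms by auto
  have "(\<Sum>x\<in>cube_verts d. walsh d S x) = (\<Sum>x\<in>cube_verts d. walsh d S (x + unit_vec d i))"
    by (simp add: sum_cube_translate unit_in_cube)
  also have "\<dots> = - (\<Sum>x\<in>cube_verts d. walsh d S x)"
    using assms i by (simp add: walsh_add walsh_unit unit_in_cube sum_negf)
  finally show ?thesis
    using False by simp
qed

lemma walsh_orthogonal:
  assumes "S \<subseteq> {..<d}" "T \<subseteq> {..<d}"
  shows "(\<Sum>x\<in>cube_verts d. walsh d S x * walsh d T x) = (if S = T then 2 ^ d else 0)"
proof -
  have "sym_diff S T \<subseteq> {..<d}" "sym_diff S T = {} \<longleftrightarrow> S = T"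
    using assms by auto
  then show ?thesis
    using assms by (simp add: walsh_mult sum_walsh)
qed

text \<open>
  The dual orthogonality relation: the sum over all subsets factors into
  \<open>\<Prod>i<d. (1 + (-1) ^ (x $ i))\<close>, which vanishes as soon as one coordinate is \<open>1\<close>. It serves both for
  Fourier inversion and for writing the condition \<open>x = 0\<close> as a sum of characters.
\<close>

lemma sum_walsh_over_index:
  assumes "x \<in> cube_verts d"
  shows "(\<Sum>S\<in>Pow {..<d}. walsh d S x) = (if x = 0\<^sub>v d then 2 ^ d else 0)"
proof -
  have "(\<Sum>S\<in>Pow {..<d}. walsh d S x) = (\<Prod>i<d. bit_sign (x $ i) + 1)"
    unfolding prod_add[OF finite_lessThan, of "\<lambda>i. bit_sign (x $ i)" "\<lambda>i. 1"]
    using assms by (intro sum.cong) (simp_all add: walsh_def)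
  moreover have "(\<Prod>i<d. bit_sign (x $ i) + 1) = 2 ^ d" if "x = 0\<^sub>v d"
  proof -
    have "(\<Prod>i<d. bit_sign (x $ i) + 1) = (\<Prod>i<d. 2)"
      using that by (intro prod.cong) auto
    then show ?thesis
      by simp
  qed
  moreover have "(\<Prod>i<d. bit_sign (x $ i) + 1) = 0" if "x \<noteq> 0\<^sub>v d"
  proof -
    have "\<exists>i<d. x $ i \<noteq> 0"
    proof (rule ccontr)
      assume "\<not> ?thesis"
      then have "x = 0\<^sub>v d"
        using assms by (intro eq_vecI) (auto simp: cube_verts_def)
      with that show False ..
    qed
    then obtain i where "i < d" "x $ i = 1"
      by auto
    then show ?thesis
      by (intro prod_zero bexI[of _ i]) simp_all
  qed
  ultimately show ?thesis
    by simp
qed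

definition walsh_coeff :: "nat \<Rightarrow> (bit vec \<Rightarrow> real) \<Rightarrow> nat set \<Rightarrow> real" where
  "walsh_coeff d \<phi> S = (\<Sum>x\<in>cube_verts d. \<phi> x * walsh d S x) / 2 ^ d"

lemma walsh_expansion:
  assumes "x \<in> cube_verts d"
  shows "(\<Sum>S\<in>Pow {..<d}. walsh_coeff d \<phi> S * walsh d S x) = \<phi> x"
proof -
  \<comment> \<open>In characteristic 2, \<open>y = x\<close> means \<open>y + x = 0\<close>, so dual orthogonality applies to \<open>y + x\<close>.\<close>
  have *: "(\<Sum>S\<in>Pow {..<d}. walsh d S y * walsh d S x) = (if y = x then 2 ^ d else 0)"
    if y: "y \<in> cube_verts d" for y
  proof -
    have "(\<Sum>S\<in>Pow {..<d}. walsh d S y * walsh d S x) = (\<Sum>S\<in>Pow {..<d}. walsh d S (y + x))"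
      using assms y by (intro sum.cong) (auto simp: walsh_add)
    moreover have "y + x = 0\<^sub>v d \<longleftrightarrow> y = x"
    proof
      assume "y + x = 0\<^sub>v d"
      then have "y = 0\<^sub>v d + x"
        using cube_add_self_cancel[OF y assms] by simp
      then show "y = x"
        using assms by (simp add: cube_verts_def)
    next
      assume "y = x"
      then show "y + x = 0\<^sub>v d"
        using cube_add_self_cancel[of "0\<^sub>v d" d x] assms by (simp add: cube_verts_def)
    qed
    ultimately show ?thesis
      using assms y by (simp add: sum_walsh_over_index add_in_cube)
  qed
  have "(\<Sum>S\<in>Pow {..<d}. walsh_coeff d \<phi> S * walsh d S x)
      = (\<Sum>S\<in>Pow {..<d}. \<Sum>y\<in>cube_verts d. \<phi> y * (walsh d S y * walsh d S x) / 2 ^ d)"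
    by (simp add: walsh_coeff_def sum_divide_distrib sum_distrib_left sum_distrib_right mult_ac)
  also have "\<dots> = (\<Sum>y\<in>cube_verts d. \<Sum>S\<in>Pow {..<d}. \<phi> y * (walsh d S y * walsh d S x) / 2 ^ d)"
    by (rule sum.swap)
  also have "\<dots> = (\<Sum>y\<in>cube_verts d. \<phi> y * (if y = x then 2 ^ d else 0) / 2 ^ d)"
    by (intro sum.cong refl)
      (simp add: * flip: sum_distrib_left sum_divide_distrib)
  also have "\<dots> = (\<Sum>y\<in>cube_verts d. if y = x then \<phi> y else 0)"
    by (intro sum.cong) auto
  also have "\<dots> = \<phi> x"
    using assms by simp
  finally show ?thesis .
qed

section \<open>The spectrum of the cube\<close>

lemma cube_adj_iff:
  assumes "x \<in> cube_verts d"
  shows "cube_adj d x y \<longleftrightarrow> (\<exists>i<d. y = x + unit_vec d i)"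
proof
  assume adj: "cube_adj d x y"
  then obtain i where i: "{i. i < d \<and> x $ i \<noteq> y $ i} = {i}"
    by (auto simp: cube_adj_def card_1_singleton_iff)
  have dim: "dim_vec x = d" "dim_vec y = d"
    using adj by (auto simp: cube_adj_def)
  have "i < d"
    using i by blast
  moreover have "y = x + unit_vec d i"
  proof (rule eq_vecI)
    fix j
    assume "j < dim_vec (x + unit_vec d i)"
    then have j: "j < d"
      using dim by simp
    have "x $ j \<noteq> y $ j \<longleftrightarrow> j = i"
      using i j by blast
    then show "y $ j = (x + unit_vec d i) $ j"
      using j dim \<open>i < d\<close> by (cases "x $ j"; cases "y $ j") auto
  qed (simp add: dim)
  ultimately show "\<exists>i<d. y = x + unit_vec d i"
    by blast
next
  assume "\<exists>i<d. y = x + unit_vec d i"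
  then obtain i where i: "i < d" "y = x + unit_vec d i"
    by blast
  have dim: "dim_vec x = d"
    using assms by (simp add: cube_verts_def)
  have "x $ j \<noteq> y $ j \<longleftrightarrow> j = i" if "j < d" for j
    using that i dim by (cases "x $ j") auto
  then have "{j. j < d \<and> x $ j \<noteq> y $ j} = {i}"
    using i(1) by auto
  then show "cube_adj d x y"
    using assms i by (simp add: cube_adj_def cube_verts_def)
qed

lemma inj_on_flip:
  assumes "x \<in> cube_verts d"
  shows "inj_on (\<lambda>i. x + unit_vec d i) {..<d}"
proof (rule inj_onI)
  fix i j
  assume ij: "i \<in> {..<d}" "j \<in> {..<d}" and eq: "x + unit_vec d i = x + unit_vec d j"
  have "(x + unit_vec d i) $ i = (x + unit_vec d j) $ i"
    using eq by simp
  then show "i = j"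
    using ij assms by (cases "x $ i") (auto simp: cube_verts_def split: if_splits)
qed

lemma cube_neighbours:
  assumes "x \<in> cube_verts d"
  shows "{y \<in> cube_verts d. cube_adj d x y} = (\<lambda>i. x + unit_vec d i) ` {..<d}"
  using assms by (auto simp: cube_adj_iff add_in_cube unit_in_cube)

lemma degree_cube:
  assumes "x \<in> cube_verts d"
  shows "degree_of (cube_verts d) (cube_adj d) x = d"
  using assms by (simp add: degree_of_def cube_neighbours card_image inj_on_flip)

text \<open>
  The cube is regular of degree \<open>d\<close>, so \<open>L\<close> averages over the \<open>d\<close> coordinate flips and subtracts the
  identity.
\<close>

lemma laplacian_cube_apply:
  assumes "x \<in> cube_verts d"
  shows "(\<Sum>y\<in>cube_verts d. laplacian (cube_verts d) (cube_adj d) x y * \<phi> y)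
      = (\<Sum>i<d. \<phi> (x + unit_vec d i)) / real d - \<phi> x"
proof -
  have "(\<Sum>y\<in>cube_verts d. laplacian (cube_verts d) (cube_adj d) x y * \<phi> y)
      = (\<Sum>y\<in>cube_verts d. (if cube_adj d x y then \<phi> y / real d else 0)
          - (if x = y then \<phi> y else 0))"
    by (intro sum.cong) (auto simp: laplacian_def degree_cube algebra_simps)
  also have "\<dots> = (\<Sum>y\<in>{y \<in> cube_verts d. cube_adj d x y}. \<phi> y / real d) - \<phi> x"
    using assms by (simp add: sum_subtractf sum.inter_filter)
  also have "\<dots> = (\<Sum>i<d. \<phi> (x + unit_vec d i)) / real d - \<phi> x"
    using assms
    by (simp add: cube_neighbours sum.reindex inj_on_flip sum_divide_distrib)
  finally show ?thesis .
qed

definition cube_eigenvalue :: "nat \<Rightarrow> nat \<Rightarrow> real" where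
  "cube_eigenvalue d i = - 2 * real i / real d"

abbreviation cube_eigenspace :: "nat \<Rightarrow> real \<Rightarrow> (bit vec \<Rightarrow> real) set" where
  "cube_eigenspace d \<equiv> eigenspace (cube_verts d) (cube_adj d)"

lemma cube_eigenvalue_eq_iff:
  "d \<ge> 1 \<Longrightarrow> cube_eigenvalue d i = cube_eigenvalue d j \<longleftrightarrow> i = j"
  by (simp add: cube_eigenvalue_def)

text \<open>
  A flip at \<open>i\<close> changes the sign of \<open>walsh d S\<close> for the \<open>card S\<close> coordinates in \<open>S\<close> and preserves it
  for the others.
\<close>

lemma sum_walsh_flips:
  assumes "S \<subseteq> {..<d}" "x \<in> cube_verts d"
  shows "(\<Sum>i<d. walsh d S (x + unit_vec d i)) = (real d - 2 * real (card S)) * walsh d S x"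
proof -
  have "(\<Sum>i<d. walsh d S (x + unit_vec d i))
      = (\<Sum>i<d. (1 - 2 * (if i \<in> S then 1 else 0)) * walsh d S x)"
    using assms by (intro sum.cong) (auto simp: walsh_add walsh_unit unit_in_cube)
  also have "\<dots> = (real d - 2 * (\<Sum>i<d. if i \<in> S then 1 else 0)) * walsh d S x"
    by (simp add: sum_subtractf flip: sum_distrib_right sum_distrib_left)
  also have "(\<Sum>i<d. if i \<in> S then 1 else 0) = real (card S)"
  proof -
    have "{..<d} \<inter> S = S"
      using assms by blast
    then show ?thesis
      by (simp flip: sum.inter_restrict)
  qed
  finally show ?thesis .
qed

lemma walsh_in_eigenspace:
  assumes "d \<ge> 1" "S \<subseteq> {..<d}"
  shows "walsh d S \<in> cube_eigenspace d (cube_eigenvalue d (card S))"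
  unfolding eigenspace_def
proof (intro CollectI conjI allI impI ballI)
  fix x
  assume x: "x \<in> cube_verts d"
  show "(\<Sum>y\<in>cube_verts d. laplacian (cube_verts d) (cube_adj d) x y * walsh d S y)
      = cube_eigenvalue d (card S) * walsh d S x"
    unfolding laplacian_cube_apply[OF x] sum_walsh_flips[OF assms(2) x]
    using assms(1) by (simp add: cube_eigenvalue_def field_simps)
qed (rule walsh_outside)

text \<open>
  The sum over flips is self-adjoint, so an eigenvector is orthogonal to all characters with another
  eigenvalue. With Fourier inversion this shows that the characters yield the whole spectrum.
\<close>

lemma walsh_coeff_eigenspace:
  assumes d: "d \<ge> 1" and S: "S \<subseteq> {..<d}" and \<phi>: "\<phi> \<in> cube_eigenspace d \<theta>"
    and ne: "\<theta> \<noteq> cube_eigenvalue d (card S)"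
  shows "walsh_coeff d \<phi> S = 0"
proof -
  let ?V = "cube_verts d"
  define c where "c = (\<Sum>x\<in>?V. \<phi> x * walsh d S x)"
  have eig: "(\<Sum>i<d. \<phi> (x + unit_vec d i)) = real d * (\<theta> + 1) * \<phi> x" if "x \<in> ?V" for x
  proof -
    have "(\<Sum>i<d. \<phi> (x + unit_vec d i)) / real d - \<phi> x = \<theta> * \<phi> x"
      using \<phi> that laplacian_cube_apply[OF that, of \<phi>] by (simp add: eigenspace_def)
    then show ?thesis
      using d by (simp add: field_simps)
  qed
  have "real d * (\<theta> + 1) * c = (\<Sum>x\<in>?V. (\<Sum>i<d. \<phi> (x + unit_vec d i)) * walsh d S x)"
    by (simp add: c_def eig sum_distrib_left mult_ac)
  also have "\<dots> = (\<Sum>i<d. \<Sum>x\<in>?V. \<phi> (x + unit_vec d i) * walsh d S x)"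
    unfolding sum_distrib_right by (rule sum.swap)
  also have "\<dots> = (\<Sum>i<d. \<Sum>x\<in>?V. \<phi> x * walsh d S (x + unit_vec d i))"
  proof (rule sum.cong[OF refl])
    fix i
    show "(\<Sum>x\<in>?V. \<phi> (x + unit_vec d i) * walsh d S x)
        = (\<Sum>x\<in>?V. \<phi> x * walsh d S (x + unit_vec d i))"
      by (subst sum_cube_translate[OF unit_in_cube[of d i], symmetric])
        (simp add: cube_add_self_cancel unit_in_cube)
  qed
  also have "\<dots> = (\<Sum>x\<in>?V. \<phi> x * (\<Sum>i<d. walsh d S (x + unit_vec d i)))"
    unfolding sum_distrib_left by (rule sum.swap)
  also have "\<dots> = (real d - 2 * real (card S)) * c"
    by (simp add: c_def sum_walsh_flips[OF S] sum_distrib_left mult_ac)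
  finally have "(real d * \<theta> + 2 * real (card S)) * c = 0"
    by (simp add: algebra_simps)
  moreover have "real d * \<theta> + 2 * real (card S) \<noteq> 0"
    using ne d by (auto simp: cube_eigenvalue_def field_simps)
  ultimately show ?thesis
    by (simp add: walsh_coeff_def c_def)
qed

lemma sum_fun_apply: "(\<Sum>a\<in>A. f a) x = (\<Sum>a\<in>A. f a x)"
  by (induction A rule: infinite_finite_induct) auto

lemma eigenspace_expansion:
  assumes "d \<ge> 1" "\<phi> \<in> cube_eigenspace d \<theta>"
  shows "\<phi> = (\<Sum>S | S \<subseteq> {..<d} \<and> cube_eigenvalue d (card S) = \<theta>.
                (\<lambda>x. walsh_coeff d \<phi> S * walsh d S x))"
proof
  fix x
  have "(\<Sum>S | S \<subseteq> {..<d} \<and> cube_eigenvalue d (card S) = \<theta>. walsh_coeff d \<phi> S * walsh d S x)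
      = (\<Sum>S\<in>Pow {..<d}. walsh_coeff d \<phi> S * walsh d S x)"
  proof (rule sum.mono_neutral_left)
    show "\<forall>S\<in>Pow {..<d} - {S. S \<subseteq> {..<d} \<and> cube_eigenvalue d (card S) = \<theta>}.
        walsh_coeff d \<phi> S * walsh d S x = 0"
    proof
      fix S
      assume "S \<in> Pow {..<d} - {S. S \<subseteq> {..<d} \<and> cube_eigenvalue d (card S) = \<theta>}"
      then have "walsh_coeff d \<phi> S = 0"
        by (intro walsh_coeff_eigenspace[OF assms(1) _ assms(2)]) auto
      then show "walsh_coeff d \<phi> S * walsh d S x = 0"
        by simp
    qed
  qed auto
  also have "\<dots> = \<phi> x"
  proof (cases "x \<in> cube_verts d")
    case False
    then show ?thesis
      using assms(2) by (simp add: walsh_outside eigenspace_def)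
  qed (rule walsh_expansion)
  finally show "\<phi> x = (\<Sum>S | S \<subseteq> {..<d} \<and> cube_eigenvalue d (card S) = \<theta>.
                (\<lambda>x. walsh_coeff d \<phi> S * walsh d S x)) x"
    by (simp add: sum_fun_apply)
qed

lemma inj_on_walsh: "inj_on (walsh d) (Pow {..<d})"
proof (rule inj_onI)
  fix S T
  assume "S \<in> Pow {..<d}" "T \<in> Pow {..<d}" "walsh d S = walsh d T"
  then show "S = T"
    using walsh_orthogonal[of S d T] walsh_orthogonal[of S d S] by (auto split: if_splits)
qed

text \<open>
  Pairing a vanishing linear combination with one of its characters isolates that coefficient.
\<close>

lemma independent_walsh:
  assumes "F \<subseteq> Pow {..<d}"
  shows "fun_vs.independent (walsh d ` F)"
proof (rule fun_vs.independent_if_scalars_zero)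
  show "finite (walsh d ` F)"
    using assms finite_subset by auto
  fix f \<psi>
  assume zero: "(\<Sum>\<chi>\<in>walsh d ` F. (\<lambda>x. f \<chi> * \<chi> x)) = 0" and "\<psi> \<in> walsh d ` F"
  then obtain T where T: "T \<in> F" "\<psi> = walsh d T"
    by blast
  have fin: "finite F"
    using assms finite_subset by auto
  have inj: "inj_on (walsh d) F"
    using inj_on_walsh assms inj_on_subset by blast
  have z: "(\<Sum>S\<in>F. f (walsh d S) * walsh d S x) = 0" for x
    using fun_cong[OF zero, of x] by (simp add: sum_fun_apply sum.reindex[OF inj])
  have "0 = (\<Sum>x\<in>cube_verts d. (\<Sum>S\<in>F. f (walsh d S) * walsh d S x) * walsh d T x)"
    by (simp add: z)
  also have "\<dots> = (\<Sum>S\<in>F. f (walsh d S) * (\<Sum>x\<in>cube_verts d. walsh d S x * walsh d T x))"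
    unfolding sum_distrib_right sum_distrib_left by (subst sum.swap) (simp add: mult_ac)
  also have "\<dots> = (\<Sum>S\<in>F. f (walsh d S) * (if S = T then 2 ^ d else 0))"
    using assms T(1) by (intro sum.cong refl) (subst walsh_orthogonal; auto)
  also have "\<dots> = (\<Sum>S\<in>F. if S = T then f (walsh d S) * 2 ^ d else 0)"
    by (intro sum.cong) auto
  also have "\<dots> = f \<psi> * 2 ^ d"
    using T fin by simp
  finally show "f \<psi> = 0"
    by simp
qed

lemma subspace_eigenspace: "fun_vs.subspace (eigenspace V E \<theta>)"
  by (auto simp: fun_vs.subspace_def eigenspace_def distrib_left sum.distrib
      mult.left_commute simp flip: sum_distrib_left)

definition level_sets :: "nat \<Rightarrow> nat \<Rightarrow> nat set set" where
  "level_sets d i = {S. S \<subseteq> {..<d} \<and> card S = i}"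

lemma is_basis_walsh:
  assumes "d \<ge> 1"
  shows "is_basis (walsh d ` level_sets d i) (cube_eigenspace d (cube_eigenvalue d i))"
  unfolding is_basis_def
proof
  show "fun_vs.independent (walsh d ` level_sets d i)"
    by (rule independent_walsh) (auto simp: level_sets_def)
  show "fun_vs.span (walsh d ` level_sets d i) = cube_eigenspace d (cube_eigenvalue d i)"
  proof (rule fun_vs.span_subspace)
    show "walsh d ` level_sets d i \<subseteq> cube_eigenspace d (cube_eigenvalue d i)"
      using walsh_in_eigenspace[OF assms] by (auto simp: level_sets_def)
    show "cube_eigenspace d (cube_eigenvalue d i) \<subseteq> fun_vs.span (walsh d ` level_sets d i)"
    proof
      fix \<phi>
      assume \<phi>: "\<phi> \<in> cube_eigenspace d (cube_eigenvalue d i)"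
      show "\<phi> \<in> fun_vs.span (walsh d ` level_sets d i)"
      proof (subst eigenspace_expansion[OF assms \<phi>], rule fun_vs.span_sum)
        fix S
        assume "S \<in> {S. S \<subseteq> {..<d} \<and> cube_eigenvalue d (card S) = cube_eigenvalue d i}"
        then have "walsh d S \<in> walsh d ` level_sets d i"
          by (auto simp: level_sets_def cube_eigenvalue_eq_iff[OF assms])
        then show "(\<lambda>x. walsh_coeff d \<phi> S * walsh d S x) \<in> fun_vs.span (walsh d ` level_sets d i)"
          by (intro fun_vs.span_scale fun_vs.span_base)
      qed
    qed
  qed (rule subspace_eigenspace)
qed

lemma dim_cube_eigenspace:
  assumes "d \<ge> 1"
  shows "fun_vs.dim (cube_eigenspace d (cube_eigenvalue d i)) = d choose i"
proof -
  let ?B = "walsh d ` level_sets d i"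
  have B: "fun_vs.independent ?B"
    "fun_vs.span ?B = cube_eigenspace d (cube_eigenvalue d i)"
    using is_basis_walsh[OF assms, of i] by (auto simp: is_basis_def)
  have "fun_vs.dim (cube_eigenspace d (cube_eigenvalue d i)) = card ?B"
    using fun_vs.dim_span_eq_card_independent[OF B(1)] B(2) by simp
  also have "\<dots> = card (level_sets d i)"
    by (intro card_image inj_on_subset[OF inj_on_walsh]) (auto simp: level_sets_def)
  also have "\<dots> = d choose i"
    by (simp add: level_sets_def n_subsets)
  finally show ?thesis .
qed

lemma eigenvalues_cube:
  assumes "d \<ge> 1"
  shows "eigenvalues (cube_verts d) (cube_adj d) = cube_eigenvalue d ` {..d}"
proof (intro subset_antisym subsetI)
  fix \<theta>
  assume "\<theta> \<in> eigenvalues (cube_verts d) (cube_adj d)"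
  then obtain \<phi> where \<phi>: "\<phi> \<in> cube_eigenspace d \<theta>" "\<phi> \<noteq> 0"
    by (auto simp: eigenvalues_def)
  have "\<exists>S\<subseteq>{..<d}. cube_eigenvalue d (card S) = \<theta>"
  proof (rule ccontr)
    assume "\<not> ?thesis"
    then have empty: "{S. S \<subseteq> {..<d} \<and> cube_eigenvalue d (card S) = \<theta>} = {}"
      by blast
    show False
      using eigenspace_expansion[OF assms \<phi>(1)] \<phi>(2) unfolding empty by simp
  qed
  then show "\<theta> \<in> cube_eigenvalue d ` {..d}"
    using card_mono[of "{..<d}"] by fastforce
next
  fix \<theta>
  assume "\<theta> \<in> cube_eigenvalue d ` {..d}"
  then obtain i where i: "i \<le> d" "\<theta> = cube_eigenvalue d i"
    by auto
  have sub: "{..<i} \<subseteq> {..<d}"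
    using i(1) by auto
  have "walsh d {..<i} \<noteq> 0"
    using walsh_zero[OF sub] by (auto simp: fun_eq_iff intro!: exI[of _ "0\<^sub>v d"])
  then show "\<theta> \<in> eigenvalues (cube_verts d) (cube_adj d)"
    using walsh_in_eigenspace[OF assms sub] i(2) by (auto simp: eigenvalues_def)
qed

lemma subspace_integrated: "fun_vs.subspace {\<phi>. integrates V W \<phi>}"
  by (auto simp: fun_vs.subspace_def integrates_def sum.distrib add_divide_distrib
      simp flip: sum_distrib_left times_divide_eq_right)

text \<open>
  Integration is a linear condition, so it does not matter on which basis it is tested; in particular
  one character that is not integrated rules out every basis of its eigenspace.
\<close>

lemma integrates_space_iff:
  assumes "is_basis B U"
  shows "integrates_space V W U \<longleftrightarrow> (\<forall>\<phi>\<in>B. integrates V W \<phi>)"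
proof
  assume "integrates_space V W U"
  then obtain C where C: "fun_vs.span C = U" "C \<subseteq> {\<phi>. integrates V W \<phi>}"
    by (auto simp: integrates_space_def is_basis_def)
  have "B \<subseteq> U"
    using assms fun_vs.span_superset by (auto simp: is_basis_def)
  then show "\<forall>\<phi>\<in>B. integrates V W \<phi>"
    using fun_vs.span_minimal[OF C(2) subspace_integrated] C(1) by blast
next
  assume "\<forall>\<phi>\<in>B. integrates V W \<phi>"
  then show "integrates_space V W U"
    using assms by (auto simp: integrates_space_def)
qed

section \<open>Kernels of binary matrices as designs\<close>

text \<open>
  The support of the sum of the rows with index in \<open>R\<close>; as \<open>R\<close> varies, these are the supports of the
  words of the dual code.
\<close>

definition row_support :: "bit mat \<Rightarrow> nat set \<Rightarrow> nat set" where
  "row_support A R = {j. j < dim_col A \<and> (\<Sum>i\<in>R. A $$ (i, j)) = 1}"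

lemma bit_sign_mult: "bit_sign (a * b) = (if a = 1 then bit_sign b else 1)"
  by (cases a) auto

text \<open>
  A character evaluated at the syndrome \<open>A *\<^sub>v x\<close> is again a character of \<open>x\<close>: the exponent
  \<open>u\<^sup>T (A x)\<close> equals \<open>(A\<^sup>T u)\<^sup>T x\<close>.
\<close>

lemma walsh_syndrome:
  assumes A: "A \<in> carrier_mat m d" and x: "x \<in> cube_verts d" and R: "R \<subseteq> {..<m}"
  shows "walsh m R (A *\<^sub>v x) = walsh d (row_support A R) x"
proof -
  have dim: "dim_vec x = d"
    using x by (simp add: cube_verts_def)
  have "walsh m R (A *\<^sub>v x) = (\<Prod>i\<in>R. bit_sign (\<Sum>j<d. A $$ (i, j) * x $ j))"
    using A R dim
    by (auto simp: walsh_def cube_verts_def scalar_prod_def atLeast0LessThan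
        simp del: mult_bit_eq_and intro!: prod.cong arg_cong[of _ _ bit_sign] sum.cong)
  also have "\<dots> = (\<Prod>j<d. \<Prod>i\<in>R. bit_sign (A $$ (i, j) * x $ j))"
    unfolding bit_sign_sum by (rule prod.swap)
  also have "\<dots> = (\<Prod>j<d. bit_sign ((\<Sum>i\<in>R. A $$ (i, j)) * x $ j))"
    unfolding bit_sign_sum sum_distrib_right ..
  also have "\<dots> = (\<Prod>j<d. if j \<in> row_support A R then bit_sign (x $ j) else 1)"
    using A by (intro prod.cong) (auto simp: bit_sign_mult row_support_def simp del: mult_bit_eq_and)
  also have "\<dots> = walsh d (row_support A R) x"
    using A by (intro walsh_alt[symmetric] x) (auto simp: row_support_def)
  finally show ?thesis .
qed

text \<open>
  Poisson summation. By dual orthogonality on the syndrome space, \<open>2 ^ m\<close> times the indicator of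
  \<open>A *\<^sub>v x = 0\<close> is the sum of all characters at the syndrome; these are characters of \<open>x\<close>, and
  orthogonality leaves one term for each \<open>R\<close> with \<open>row_support A R = S\<close>. The case \<open>S = {}\<close> gives the
  number of codewords.
\<close>

lemma sum_walsh_kernel:
  assumes A: "A \<in> carrier_mat m d" and S: "S \<subseteq> {..<d}"
  shows "(\<Sum>w\<in>mat_kernel A. walsh d S w)
    = 2 ^ d / 2 ^ m * real (card {R. R \<subseteq> {..<m} \<and> row_support A R = S})"
proof -
  let ?V = "cube_verts d"
  have sub: "row_support A R \<subseteq> {..<d}" for R
    using A by (auto simp: row_support_def)
  have syn: "A *\<^sub>v x \<in> cube_verts m" if "x \<in> ?V" for x
    using A that by (simp add: cube_verts_def)
  have ker: "mat_kernel A = {x \<in> ?V. A *\<^sub>v x = 0\<^sub>v m}"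
    using mat_kernel[OF A] by (simp add: cube_verts_def)
  have "2 ^ m * (\<Sum>w\<in>mat_kernel A. walsh d S w)
      = (\<Sum>x\<in>?V. walsh d S x * (if A *\<^sub>v x = 0\<^sub>v m then 2 ^ m else 0))"
    unfolding ker by (simp add: sum.inter_filter sum_distrib_left mult_ac if_distrib cong: if_cong)
  also have "\<dots> = (\<Sum>x\<in>?V. walsh d S x * (\<Sum>R\<in>Pow {..<m}. walsh m R (A *\<^sub>v x)))"
    by (simp add: sum_walsh_over_index syn)
  also have "\<dots> = (\<Sum>x\<in>?V. \<Sum>R\<in>Pow {..<m}. walsh d S x * walsh d (row_support A R) x)"
    by (simp add: sum_distrib_left walsh_syndrome[OF A])
  also have "\<dots> = (\<Sum>R\<in>Pow {..<m}. \<Sum>x\<in>?V. walsh d S x * walsh d (row_support A R) x)"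
    by (rule sum.swap)
  also have "\<dots> = (\<Sum>R\<in>Pow {..<m}. if row_support A R = S then 2 ^ d else 0)"
    by (intro sum.cong refl) (auto simp: walsh_orthogonal[OF S sub])
  also have "\<dots> = 2 ^ d * real (card {R. R \<subseteq> {..<m} \<and> row_support A R = S})"
    by (simp flip: sum.inter_filter Pow_def)
  finally show ?thesis
    by (simp add: field_simps)
qed

lemma integrates_walsh_iff:
  assumes "S \<subseteq> {..<d}" "W \<subseteq> cube_verts d" "W \<noteq> {}"
  shows "integrates (cube_verts d) W (walsh d S)
    \<longleftrightarrow> S = {} \<or> (\<Sum>w\<in>W. walsh d S w) = 0"
proof -
  have W: "finite W"
    using assms(2) finite_subset finite_cube_verts by blast
  then have pos: "card W > 0"
    using assms(3) by auto
  show ?thesis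
  proof (cases "S = {}")
    case True
    have "(\<Sum>w\<in>W. walsh d {} w) = real (card W)"
      using assms(2) by (simp add: walsh_empty subset_eq)
    then show ?thesis
      using pos True by (simp add: integrates_def sum_walsh card_cube_verts)
  next
    case False
    then show ?thesis
      using pos assms(1) W assms(3) by (simp add: integrates_def sum_walsh)
  qed
qed

section \<open>Lifted Hamming codes\<close>

text \<open>
  The character of \<open>R\<close> sums to \<open>0\<close>, so it takes the values \<open>1\<close> and \<open>-1\<close> equally often.
\<close>

lemma card_nontrivial_halfspace:
  assumes "R \<subseteq> {..<r}" "R \<noteq> {}"
  shows "2 * card {v \<in> cube_verts r. (\<Sum>i\<in>R. v $ i) = 1} = 2 ^ r"
proof -
  let ?V = "cube_verts r" and ?H = "{v \<in> cube_verts r. (\<Sum>i\<in>R. v $ i) = 1}"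
  have "0 = (\<Sum>v\<in>?V. walsh r R v)"
    using assms by (simp add: sum_walsh)
  also have "\<dots> = (\<Sum>v\<in>?V. 1 - (if (\<Sum>i\<in>R. v $ i) = 1 then 2 else 0))"
  proof (rule sum.cong[OF refl])
    fix v
    assume "v \<in> ?V"
    then have "walsh r R v = bit_sign (\<Sum>i\<in>R. v $ i)"
      by (simp add: walsh_def bit_sign_sum)
    then show "walsh r R v = 1 - (if (\<Sum>i\<in>R. v $ i) = 1 then 2 else 0)"
      by (simp add: bit_sign_def)
  qed
  also have "\<dots> = 2 ^ r - 2 * real (card ?H)"
    by (simp add: sum_subtractf card_cube_verts flip: sum.inter_filter)
  finally have "2 * real (card ?H) = 2 ^ r"
    by simp
  then have "real (2 * card ?H) = real (2 ^ r)"
    by simp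
  then show ?thesis
    using of_nat_eq_iff by blast
qed

text \<open>
  Each nonzero vector occurs once as a column, so the positions in the support of a sum of rows
  correspond to the vectors in the complement of a hyperplane; neither the missing vector \<open>0\<close> nor the
  appended zero columns contribute. Hence the dual code has constant weight.
\<close>

lemma card_row_support_hamming:
  assumes M: "hamming_check_matrix r M" and R: "R \<subseteq> {..<r}" "R \<noteq> {}"
  shows "card (row_support (append_zero_cols m M) R) = 2 ^ (r - 1)"
proof -
  have car: "M \<in> carrier_mat r (2 ^ r - 1)"
    and bij: "bij_betw (col M) {..<2 ^ r - 1} (cube_verts r - {0\<^sub>v r})"
    using M by (auto simp: hamming_check_matrix_def cube_verts_def)
  let ?H = "{v \<in> cube_verts r. (\<Sum>i\<in>R. v $ i) = 1}"
  have entry: "(\<Sum>i\<in>R. col M j $ i) = (\<Sum>i\<in>R. M $$ (i, j))" if "j < 2 ^ r - 1" for j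
    using car R(1) that by (intro sum.cong) auto
  let ?J = "{j. j < 2 ^ r - 1 \<and> (\<Sum>i\<in>R. col M j $ i) = 1}"
  have supp: "row_support (append_zero_cols m M) R = ?J"
  proof -
    have "(\<Sum>i\<in>R. append_zero_cols m M $$ (i, j)) = (if j < 2 ^ r - 1 then \<Sum>i\<in>R. M $$ (i, j) else 0)"
      if "j < 2 ^ r - 1 + m" for j
      using that car R(1) by (auto simp: append_zero_cols_def intro!: sum.cong sum.neutral)
    then show ?thesis
      using car by (auto simp: row_support_def append_zero_cols_def entry split: if_splits)
  qed
  have "card ?J = card (col M ` ?J)"
    using bij by (intro card_image[symmetric] inj_on_subset[OF bij_betw_imp_inj_on[OF bij]]) auto
  also have "col M ` ?J = ?H"
  proof -
    have "(\<Sum>i\<in>R. 0\<^sub>v r $ i) = (0 :: bit)"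
      using R(1) by (intro sum.neutral) auto
    then have "?H = {v \<in> cube_verts r - {0\<^sub>v r}. (\<Sum>i\<in>R. v $ i) = 1}"
      by auto
    also have "\<dots> = col M ` ?J"
      unfolding bij_betw_imp_surj_on[OF bij, symmetric] by auto
    finally show ?thesis ..
  qed
  also have "card ?H = 2 ^ (r - 1)"
  proof -
    have "r > 0"
      using R by auto
    then have "(2 :: nat) ^ r = 2 * 2 ^ (r - 1)"
      by (cases r) auto
    then show ?thesis
      using card_nontrivial_halfspace[OF R] by simp
  qed
  finally show ?thesis
    unfolding supp .
qed

text \<open>
  Nonempty row combinations have nonempty support, so the empty set is the support of only the empty
  combination: this gives the size of the code. All other supports lie on the level \<open>2 ^ (r - 1)\<close>,
  where the support of the row with index \<open>0\<close> gives a character that is not integrated.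
\<close>

lemma
  assumes r: "r \<ge> 2" and M: "hamming_check_matrix r M" and m: "m \<ge> 1"
    and d: "d = 2 ^ r - 1 + m"
  shows lifted_code_subset: "lifted_code m M \<subseteq> cube_verts d"
    and card_lifted_code: "real (card (lifted_code m M)) = 2 ^ d / 2 ^ r"
    and lifted_code_integrates_iff:
      "i \<le> d \<Longrightarrow> integrates_space (cube_verts d) (lifted_code m M)
          (cube_eigenspace d (cube_eigenvalue d i)) \<longleftrightarrow> i \<noteq> 2 ^ (r - 1)"
proof -
  let ?A = "append_zero_cols m M"
  have A: "?A \<in> carrier_mat r d"
    using M d by (auto simp: hamming_check_matrix_def append_zero_cols_def)
  show sub: "lifted_code m M \<subseteq> cube_verts d"
    using mat_kernel_carrier[OF A] by (simp add: lifted_code_def cube_verts_def)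
  have row_empty: "row_support ?A {} = {}"
    by (simp add: row_support_def)
  have row_card: "card (row_support ?A R) = (if R = {} then 0 else 2 ^ (r - 1))"
    if "R \<subseteq> {..<r}" for R
    using card_row_support_hamming[OF M that] row_empty by simp
  have row_sub: "row_support ?A R \<subseteq> {..<d}" for R
    using A by (auto simp: row_support_def)
  have "{R. R \<subseteq> {..<r} \<and> row_support ?A R = {}} = {{}}"
  proof -
    have "R = {}" if "R \<subseteq> {..<r}" "row_support ?A R = {}" for R
      using row_card[OF that(1)] that(2) by (auto split: if_splits)
    then show ?thesis
      using row_empty by blast
  qed
  then have "(\<Sum>w\<in>lifted_code m M. walsh d {} w) = 2 ^ d / 2 ^ r"
    using sum_walsh_kernel[OF A, of "{}"] by (simp add: lifted_code_def)
  then show card: "real (card (lifted_code m M)) = 2 ^ d / 2 ^ r"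
    using sub by (simp add: walsh_empty subset_eq)
  then have ne: "lifted_code m M \<noteq> {}"
    by auto
  have int_iff: "integrates (cube_verts d) (lifted_code m M) (walsh d S)
      \<longleftrightarrow> S = {} \<or> {R. R \<subseteq> {..<r} \<and> row_support ?A R = S} = {}" if "S \<subseteq> {..<d}" for S
  proof -
    have "finite {R. R \<subseteq> {..<r} \<and> row_support ?A R = S}"
      by (rule finite_subset[of _ "Pow {..<r}"]) auto
    then show ?thesis
      unfolding integrates_walsh_iff[OF that sub ne]
      using sum_walsh_kernel[OF A that] by (simp add: lifted_code_def)
  qed
  assume "i \<le> d"
  have "(2 :: nat) ^ r \<ge> 1"
    by simp
  then have "d \<ge> 1"
    using m d by linarith
  show "integrates_space (cube_verts d) (lifted_code m M)
          (cube_eigenspace d (cube_eigenvalue d i)) \<longleftrightarrow> i \<noteq> 2 ^ (r - 1)"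
    unfolding integrates_space_iff[OF is_basis_walsh[OF \<open>d \<ge> 1\<close>]]
  proof (intro iffI notI ballI)
    assume all: "\<forall>\<phi>\<in>walsh d ` level_sets d i. integrates (cube_verts d) (lifted_code m M) \<phi>"
      and i: "i = 2 ^ (r - 1)"
    define S where "S = row_support ?A {0}"
    have "card S = i"
      using row_card[of "{0}"] r i by (simp add: S_def)
    moreover have "S \<subseteq> {..<d}"
      using row_sub by (simp add: S_def)
    ultimately have "integrates (cube_verts d) (lifted_code m M) (walsh d S)"
      using all by (auto simp: level_sets_def)
    then have "S = {} \<or> {R. R \<subseteq> {..<r} \<and> row_support ?A R = S} = {}"
      using int_iff \<open>S \<subseteq> {..<d}\<close> by blast
    moreover have "{0} \<in> {R. R \<subseteq> {..<r} \<and> row_support ?A R = S}"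
      using r by (simp add: S_def)
    ultimately show False
      using \<open>card S = i\<close> i by auto
  next
    fix \<phi>
    assume i: "i \<noteq> 2 ^ (r - 1)" and "\<phi> \<in> walsh d ` level_sets d i"
    then obtain S where S: "S \<subseteq> {..<d}" "card S = i" "\<phi> = walsh d S"
      by (auto simp: level_sets_def)
    have "S = {}" if "R \<subseteq> {..<r}" "row_support ?A R = S" for R
      using row_card[OF that(1)] that(2) i S(2) row_empty by (auto split: if_splits)
    then show "integrates (cube_verts d) (lifted_code m M) \<phi>"
      using int_iff[OF S(1)] S(3) by blast
  qed
qed

section \<open>Frequency orderings and efficacy\<close>

lemma frequency_ordering_ending_with:
  assumes fin: "finite (eigenvalues V E)" and bound: "\<And>\<theta>. \<theta> \<in> eigenvalues V E \<Longrightarrow> \<bar>\<theta> + 1\<bar> \<le> 1"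
    and zero: "0 \<in> eigenvalues V E" and \<mu>: "\<mu> \<in> eigenvalues V E" "\<mu> \<noteq> 0"
    and least: "\<And>\<theta>. \<theta> \<in> eigenvalues V E \<Longrightarrow> \<bar>\<mu> + 1\<bar> \<le> \<bar>\<theta> + 1\<bar>"
  obtains ls where "frequency_ordering V E (ls @ [\<mu>])"
proof
  \<comment> \<open>\<open>sort_key\<close> sorts upwards, hence the sign; the forced first and the chosen last entry are set apart.\<close>
  let ?mid = "sort_key (\<lambda>\<theta>. - \<bar>\<theta> + 1\<bar>) (sorted_list_of_set (eigenvalues V E - {0, \<mu>}))"
  have "sorted (map (\<lambda>\<theta>. - \<bar>\<theta> + 1\<bar>) ?mid)"
    by (rule sorted_sort_key)
  then have "sorted_wrt (\<lambda>\<theta> \<nu>. \<bar>\<theta> + 1\<bar> \<ge> \<bar>\<nu> + 1\<bar>) ?mid"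
    by (simp add: sorted_map)
  then show "frequency_ordering V E ((0 # ?mid) @ [\<mu>])"
    using fin zero \<mu> bound least by (auto simp: frequency_ordering_def sorted_wrt_append)
qed

text \<open>
  If exactly one eigenspace is not integrated and it may come last, then the best initial segment
  consists of all the others: every initial segment on which \<open>W\<close> succeeds avoids that eigenspace,
  and an ordering that ends with it attains the bound.
\<close>

lemma
  assumes d: "d \<ge> 1" and m: "1 \<le> m" "m \<le> d"
    and W: "W \<subseteq> cube_verts d" "W \<noteq> {}"
    and int: "\<And>i. i \<le> d \<Longrightarrow> integrates_space (cube_verts d) W
        (cube_eigenspace d (cube_eigenvalue d i)) \<longleftrightarrow> i \<noteq> m"
    and least: "\<And>i. i \<le> d \<Longrightarrow> \<bar>cube_eigenvalue d m + 1\<bar> \<le> \<bar>cube_eigenvalue d i + 1\<bar>"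
  shows graphical_design_all_but_last: "graphical_design (cube_verts d) (cube_adj d) d W"
    and efficacy_all_but_last: "efficacy (cube_verts d) (cube_adj d) W
      = real (card W) / (2 ^ d - real (d choose m))"
proof -
  let ?V = "cube_verts d" and ?E = "cube_adj d" and ?\<mu> = "cube_eigenvalue d m"
  let ?dim = "\<lambda>\<theta>. fun_vs.dim (cube_eigenspace d \<theta>)"
  define \<Theta> where "\<Theta> = eigenvalues ?V ?E"
  have \<Theta>: "\<Theta> = cube_eigenvalue d ` {..d}"
    using eigenvalues_cube[OF d] by (simp add: \<Theta>_def)
  have fin: "finite \<Theta>"
    by (simp add: \<Theta>)
  have inj: "inj_on (cube_eigenvalue d) A" for A
    using cube_eigenvalue_eq_iff[OF d] by (auto intro: inj_onI)
  have card\<Theta>: "card \<Theta> = d + 1"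
    by (simp add: \<Theta> card_image inj)
  have int\<Theta>: "integrates_space ?V W (cube_eigenspace d \<theta>) \<longleftrightarrow> \<theta> \<noteq> ?\<mu>" if "\<theta> \<in> \<Theta>" for \<theta>
    using that int cube_eigenvalue_eq_iff[OF d] by (auto simp: \<Theta>)
  obtain ls where ls: "frequency_ordering ?V ?E (ls @ [?\<mu>])"
  proof (rule frequency_ordering_ending_with)
    show "finite (eigenvalues ?V ?E)"
      using fin by (simp add: \<Theta>_def)
    show "\<bar>\<theta> + 1\<bar> \<le> 1" if "\<theta> \<in> eigenvalues ?V ?E" for \<theta>
      using that d by (auto simp: cube_eigenvalue_def eigenvalues_cube abs_le_iff field_simps)
    show "0 \<in> eigenvalues ?V ?E"
      using d by (auto simp: eigenvalues_cube cube_eigenvalue_def intro!: image_eqI[of _ _ 0])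
    show "?\<mu> \<in> eigenvalues ?V ?E" "?\<mu> \<noteq> 0"
      using d m by (auto simp: eigenvalues_cube cube_eigenvalue_def)
    show "\<bar>?\<mu> + 1\<bar> \<le> \<bar>\<theta> + 1\<bar>" if "\<theta> \<in> eigenvalues ?V ?E" for \<theta>
      using that least by (auto simp: eigenvalues_cube[OF d])
  qed
  have dist: "distinct (ls @ [?\<mu>])" and set_ls: "set (ls @ [?\<mu>]) = \<Theta>"
    using ls by (auto simp: frequency_ordering_def \<Theta>_def)
  have len: "length ls = d"
    using distinct_card[OF dist] set_ls card\<Theta> by simp
  have set_init: "set ls = \<Theta> - {?\<mu>}"
    unfolding set_ls[symmetric] using dist by auto
  have first: "integrates_first ?V ?E W (ls @ [?\<mu>]) d"
    unfolding integrates_first_def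
  proof (intro conjI allI impI)
    fix i
    assume "i < d"
    then have "(ls @ [?\<mu>]) ! i \<in> \<Theta> - {?\<mu>}"
      unfolding set_init[symmetric] by (simp add: nth_append len)
    then show "integrates_space ?V W (cube_eigenspace d ((ls @ [?\<mu>]) ! i))"
      by (simp only: int\<Theta> Diff_iff singleton_iff not_False_eq_True)
  qed (use d len in auto)
  show "graphical_design ?V ?E d W"
    using W ls first by (auto simp: graphical_design_def)

  have sum_dim: "(\<Sum>i<k. ?dim (xs ! i)) = (\<Sum>\<theta>\<in>(!) xs ` {..<k}. ?dim \<theta>)"
    if "distinct xs" "k \<le> length xs" for xs k
    using that by (subst sum.reindex) (auto intro: inj_on_nth)
  have total: "real (\<Sum>\<theta>\<in>\<Theta> - {?\<mu>}. ?dim \<theta>) = 2 ^ d - real (d choose m)"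
  proof -
    have "\<Theta> - {?\<mu>} = cube_eigenvalue d ` ({..d} - {m})"
      using cube_eigenvalue_eq_iff[OF d] by (auto simp: \<Theta>)
    then have "(\<Sum>\<theta>\<in>\<Theta> - {?\<mu>}. ?dim \<theta>) = (\<Sum>i\<in>{..d} - {m}. d choose i)"
      by (simp add: sum.reindex inj dim_cube_eigenspace[OF d])
    moreover have "(d choose m) + (\<Sum>i\<in>{..d} - {m}. d choose i) = 2 ^ d"
      using m by (simp add: choose_row_sum flip: sum.remove)
    ultimately have "real (d choose m) + real (\<Sum>\<theta>\<in>\<Theta> - {?\<mu>}. ?dim \<theta>) = real (2 ^ d)"
      by (metis of_nat_add)
    then show ?thesis
      by simp
  qed
  let ?X = "{real (card W) / real (\<Sum>i<k. ?dim (xs ! i)) | xs k.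
      frequency_ordering ?V ?E xs \<and> integrates_first ?V ?E W xs k}"
  show "efficacy ?V ?E W = real (card W) / (2 ^ d - real (d choose m))"
    unfolding efficacy_def
  proof (rule Min_eqI)
    let ?P = "{xs. set xs \<subseteq> \<Theta> \<and> length xs \<le> d + 1} \<times> {..d + 1}"
    have "?X \<subseteq> (\<lambda>(xs, k). real (card W) / real (\<Sum>i<k. ?dim (xs ! i))) ` ?P"
    proof
      fix q
      assume "q \<in> ?X"
      then obtain xs k where q: "q = real (card W) / real (\<Sum>i<k. ?dim (xs ! i))"
        and xs: "frequency_ordering ?V ?E xs" and k: "integrates_first ?V ?E W xs k"
        by blast
      have "set xs = \<Theta>" "length xs = d + 1"
        using xs distinct_card[of xs] card\<Theta> by (auto simp: frequency_ordering_def \<Theta>_def)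
      then have "(xs, k) \<in> ?P"
        using k by (auto simp: integrates_first_def)
      then show "q \<in> (\<lambda>(xs, k). real (card W) / real (\<Sum>i<k. ?dim (xs ! i))) ` ?P"
        unfolding q by (rule rev_image_eqI) simp
    qed
    then show "finite ?X"
      by (rule finite_subset) (intro finite_imageI finite_cartesian_product
          finite_lists_length_le fin finite_atMost)
  next
    fix q
    assume "q \<in> ?X"
    then obtain xs k where q: "q = real (card W) / real (\<Sum>i<k. ?dim (xs ! i))"
      and xs: "frequency_ordering ?V ?E xs" and k: "integrates_first ?V ?E W xs k"
      by blast
    have k': "1 \<le> k" "k \<le> length xs" "distinct xs"
      using xs k by (auto simp: integrates_first_def frequency_ordering_def)
    have sub: "(!) xs ` {..<k} \<subseteq> \<Theta> - {?\<mu>}"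
    proof
      fix \<theta>
      assume "\<theta> \<in> (!) xs ` {..<k}"
      then obtain i where i: "i < k" "\<theta> = xs ! i"
        by blast
      then have "\<theta> \<in> set xs"
        using k' by auto
      then have "\<theta> \<in> \<Theta>"
        using xs by (simp add: frequency_ordering_def \<Theta>_def)
      moreover have "integrates_space ?V W (cube_eigenspace d \<theta>)"
        using k i by (simp add: integrates_first_def)
      ultimately show "\<theta> \<in> \<Theta> - {?\<mu>}"
        using int\<Theta>[of \<theta>] by simp
    qed
    have le: "(\<Sum>i<k. ?dim (xs ! i)) \<le> (\<Sum>\<theta>\<in>\<Theta> - {?\<mu>}. ?dim \<theta>)"
      unfolding sum_dim[OF k'(3,2)] using sub fin by (intro sum_mono2) auto
    \<comment> \<open>The segment contains the constants, so the denominator is positive and the quotient antitone in it.\<close>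
    have "xs ! 0 = cube_eigenvalue d 0"
      using xs by (auto simp: frequency_ordering_def cube_eigenvalue_def simp flip: hd_conv_nth)
    then have "?dim (xs ! 0) = 1"
      by (simp add: dim_cube_eigenspace[OF d])
    moreover have "?dim (xs ! 0) \<le> (\<Sum>i<k. ?dim (xs ! i))"
      using k'(1) by (intro member_le_sum) auto
    ultimately have "0 < real (\<Sum>i<k. ?dim (xs ! i))"
      by (simp only: of_nat_0_less_iff)
    then show "real (card W) / (2 ^ d - real (d choose m)) \<le> q"
      unfolding q total[symmetric] using le by (intro divide_left_mono mult_pos_pos) linarith+
  next
    have "(!) (ls @ [?\<mu>]) ` {..<d} = set ls"
      using len by (auto simp: nth_append in_set_conv_nth image_iff)
    also note set_init
    finally have "real (\<Sum>i<d. ?dim ((ls @ [?\<mu>]) ! i)) = 2 ^ d - real (d choose m)"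
      using sum_dim[OF dist, of d] len total by simp
    then show "real (card W) / (2 ^ d - real (d choose m)) \<in> ?X"
      using ls first by (intro CollectI exI[of _ "ls @ [?\<mu>]"] exI[of _ d]) simp
  qed
qed

text \<open>
  With \<open>k = 2 ^ (r - 1)\<close>, the eigenvalue of level \<open>k\<close> plus \<open>1\<close> is \<open>0\<close> for \<open>d = 2 * k\<close> and \<open>1 / d\<close>
  for \<open>d = 2 * k + 1\<close>. In both cases no level has a smaller absolute value.
\<close>

lemma
  assumes r: "r \<ge> 2" and M: "hamming_check_matrix r M"
  shows hamming_lift_one_design: "graphical_design (cube_verts (2 ^ r)) (cube_adj (2 ^ r)) (2 ^ r)
      (lifted_code 1 M)"
    and hamming_lift_two_design: "graphical_design (cube_verts (2 ^ r + 1)) (cube_adj (2 ^ r + 1))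
      (2 ^ r + 1) (lifted_code 2 M)"
    and hamming_lift_one_efficacy: "efficacy (cube_verts (2 ^ r)) (cube_adj (2 ^ r)) (lifted_code 1 M)
      = 2 ^ (2 ^ r) / 2 ^ r / (2 ^ (2 ^ r) - real ((2 ^ r) choose (2 ^ (r - 1))))"
    and hamming_lift_two_efficacy: "efficacy (cube_verts (2 ^ r + 1)) (cube_adj (2 ^ r + 1))
        (lifted_code 2 M)
      = 2 ^ (2 ^ r + 1) / 2 ^ r / (2 ^ (2 ^ r + 1) - real ((2 ^ r + 1) choose (2 ^ (r - 1))))"
proof -
  define k :: nat where "k = 2 ^ (r - 1)"
  have k: "2 ^ r = 2 * k" "k \<ge> 1"
    using r by (auto simp: k_def simp flip: power_Suc)
  have code: "lifted_code m M \<subseteq> cube_verts d" "real (card (lifted_code m M)) = 2 ^ d / 2 ^ r"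
    "lifted_code m M \<noteq> {}"
    "i \<le> d \<Longrightarrow> integrates_space (cube_verts d) (lifted_code m M)
          (cube_eigenspace d (cube_eigenvalue d i)) \<longleftrightarrow> i \<noteq> k"
    if "m \<ge> 1" "d = 2 ^ r - 1 + m" for m d i
  proof -
    show "real (card (lifted_code m M)) = 2 ^ d / 2 ^ r"
      by (rule card_lifted_code[OF r M that])
    then show "lifted_code m M \<noteq> {}"
      by auto
  qed (use lifted_code_subset[OF r M that] lifted_code_integrates_iff[OF r M that] in
      \<open>auto simp: k_def\<close>)
  have d1: "(2 :: nat) ^ r = 2 ^ r - 1 + 1" and d2: "(2 :: nat) ^ r + 1 = 2 ^ r - 1 + 2"
    by simp_all
  have least1: "\<bar>cube_eigenvalue (2 ^ r) k + 1\<bar> \<le> \<bar>cube_eigenvalue (2 ^ r) i + 1\<bar>" for i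
    using k by (simp add: cube_eigenvalue_def)
  have least2: "\<bar>cube_eigenvalue (2 ^ r + 1) k + 1\<bar> \<le> \<bar>cube_eigenvalue (2 ^ r + 1) i + 1\<bar>" for i
  proof -
    have *: "cube_eigenvalue (2 ^ r + 1) j + 1 = (2 * (real k - real j) + 1) / (2 * real k + 1)" for j
      unfolding k(1) by (simp add: cube_eigenvalue_def field_simps)
    \<comment> \<open>An odd integer has absolute value at least 1; parity is only visible over the integers.\<close>
    have "1 \<le> \<bar>2 * (real k - real i) + 1\<bar>"
    proof -
      have "1 \<le> \<bar>2 * (int k - int i) + 1\<bar>"
        by presburger
      then have "real_of_int 1 \<le> real_of_int \<bar>2 * (int k - int i) + 1\<bar>"
        by (simp only: of_int_le_iff)
      then show ?thesis
        by simp
    qed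
    then show ?thesis
      unfolding * by (simp add: abs_divide divide_right_mono)
  qed
  have le1: "1 \<le> (2 :: nat) ^ r" "k \<le> 2 ^ r" and le2: "1 \<le> (2 :: nat) ^ r + 1" "k \<le> 2 ^ r + 1"
    using k by simp_all
  note code1 = code[OF order_refl d1] and code2 = code[OF one_le_numeral d2]
  note lift1 = le1(1) k(2) le1(2) code1(1,3,4) least1
  note lift2 = le2(1) k(2) le2(2) code2(1,3,4) least2
  show "graphical_design (cube_verts (2 ^ r)) (cube_adj (2 ^ r)) (2 ^ r) (lifted_code 1 M)"
    by (rule graphical_design_all_but_last[OF lift1])
  show "graphical_design (cube_verts (2 ^ r + 1)) (cube_adj (2 ^ r + 1)) (2 ^ r + 1)
      (lifted_code 2 M)"
    by (rule graphical_design_all_but_last[OF lift2])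
  show "efficacy (cube_verts (2 ^ r)) (cube_adj (2 ^ r)) (lifted_code 1 M)
      = 2 ^ (2 ^ r) / 2 ^ r / (2 ^ (2 ^ r) - real ((2 ^ r) choose (2 ^ (r - 1))))"
    using efficacy_all_but_last[OF lift1] unfolding code1(2) k_def .
  show "efficacy (cube_verts (2 ^ r + 1)) (cube_adj (2 ^ r + 1)) (lifted_code 2 M)
      = 2 ^ (2 ^ r + 1) / 2 ^ r / (2 ^ (2 ^ r + 1) - real ((2 ^ r + 1) choose (2 ^ (r - 1))))"
    using efficacy_all_but_last[OF lift2] unfolding code2(2) k_def .
qed

section \<open>Central binomial coefficients\<close>

text \<open>
  Pascal's rule adds the two middle entries of row \<open>2 * k + 1\<close>, which are equal. This turns the density of the middle level in
  odd dimension \<open>2 * k + 1\<close> into a central density with index \<open>Suc k\<close>.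
\<close>

lemma central_binomial_eq_double:
  "(2 * Suc k) choose (Suc k) = 2 * (Suc (2 * k) choose k)"
  using binomial_symmetric[of k "Suc (2 * k)"] by simp

lemma central_binomial_Suc:
  "Suc k * ((2 * Suc k) choose (Suc k)) = 2 * Suc (2 * k) * ((2 * k) choose k)"
proof -
  have "Suc k * (Suc (2 * k) choose k) = Suc (2 * k) * ((2 * k) choose k)"
    using Suc_times_binomial[of k "2 * k"] binomial_symmetric[of k "Suc (2 * k)"] by simp
  then show ?thesis
    unfolding central_binomial_eq_double by (metis mult.assoc mult.left_commute)
qed

text \<open>
  The bound is preserved by the recurrence because \<open>(2 * k + 1) * (2 * k + 3) \<le> (2 * k + 2)\<^sup>2\<close>.
\<close>

lemma central_binomial_square_le:
  "(real ((2 * k) choose k) / 4 ^ k)\<^sup>2 \<le> 1 / (2 * real k + 1)"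
proof (induction k)
  case (Suc k)
  let ?c = "\<lambda>k. real ((2 * k) choose k) / 4 ^ k"
  define b where "b = real ((2 * Suc k) choose (Suc k))"
  have "real (Suc k * ((2 * Suc k) choose (Suc k))) = real (2 * Suc (2 * k) * ((2 * k) choose k))"
    unfolding central_binomial_Suc ..
  then have "(real k + 1) * b = 2 * (2 * real k + 1) * real ((2 * k) choose k)"
    unfolding b_def of_nat_mult by (simp add: add.commute)
  moreover have "real k + 1 \<noteq> 0"
    by linarith
  ultimately have b: "b = 2 * (2 * real k + 1) * real ((2 * k) choose k) / (real k + 1)"
    by (metis nonzero_mult_div_cancel_left)
  have "2 * x * c / q / (4 * p) = c / p * (x / (2 * q))" for x c p q :: real
    by simp
  from this[of "2 * real k + 1" "real ((2 * k) choose k)" "real k + 1" "4 ^ k"]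
  have "b / 4 ^ Suc k = ?c k * ((2 * real k + 1) / (2 * real k + 2))"
    unfolding b by (simp add: distrib_left)
  then have "?c (Suc k) = ?c k * ((2 * real k + 1) / (2 * real k + 2))"
    unfolding b_def .
  then have "(?c (Suc k))\<^sup>2 = (?c k)\<^sup>2 * ((2 * real k + 1) / (2 * real k + 2))\<^sup>2"
    by (simp only: power_mult_distrib)
  also have "\<dots> \<le> 1 / (2 * real k + 1) * ((2 * real k + 1) / (2 * real k + 2))\<^sup>2"
    by (intro mult_right_mono Suc.IH) simp
  also have "\<dots> = (2 * real k + 1) / (2 * real k + 2)\<^sup>2"
    by (simp add: power_divide power2_eq_square)
  also have "\<dots> \<le> 1 / (2 * real (Suc k) + 1)"
    by (simp add: divide_simps power2_eq_square) (simp add: algebra_simps)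
  finally show ?case .
qed simp

lemma central_binomial_density_tendsto_0:
  "(\<lambda>k. real ((2 * k) choose k) / 4 ^ k) \<longlonglongrightarrow> 0"
proof -
  have "(\<lambda>k. (real ((2 * k) choose k) / 4 ^ k)\<^sup>2) \<longlonglongrightarrow> 0"
  proof (rule tendsto_sandwich)
    show "eventually (\<lambda>k. 0 \<le> (real ((2 * k) choose k) / 4 ^ k)\<^sup>2) at_top"
      by (rule always_eventually) (rule allI, rule zero_le_power2)
    have "1 / (2 * real k + 1) \<le> inverse (real (Suc k))" for k
      unfolding inverse_eq_divide by (rule divide_left_mono) simp_all
    then show "eventually (\<lambda>k. (real ((2 * k) choose k) / 4 ^ k)\<^sup>2 \<le> inverse (real (Suc k))) at_top"
      by (intro always_eventually allI order_trans[OF central_binomial_square_le])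
    show "(\<lambda>k :: nat. 0 :: real) \<longlonglongrightarrow> 0"
      by (rule tendsto_const)
    show "(\<lambda>k. inverse (real (Suc k))) \<longlonglongrightarrow> 0"
      by (rule LIMSEQ_inverse_real_of_nat)
  qed
  then have "(\<lambda>k. sqrt ((real ((2 * k) choose k) / 4 ^ k)\<^sup>2)) \<longlonglongrightarrow> sqrt 0"
    by (rule tendsto_real_sqrt)
  then show ?thesis
    by simp
qed

lemma asymp_equiv_central_density:
  assumes "eventually (\<lambda>r. f r = 1 / 2 ^ r / (1 - real ((2 * h r) choose (h r)) / 4 ^ h r)) at_top"
    and "filterlim h at_top at_top"
  shows "f \<sim>[at_top] (\<lambda>r :: nat. 1 / 2 ^ r :: real)"
proof (rule asymp_equivI')
  have "(\<lambda>r. real ((2 * h r) choose (h r)) / 4 ^ h r) \<longlonglongrightarrow> 0"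
    by (rule filterlim_compose[OF central_binomial_density_tendsto_0 assms(2)])
  then have "(\<lambda>r. 1 / (1 - real ((2 * h r) choose (h r)) / 4 ^ h r)) \<longlonglongrightarrow> 1 / (1 - 0)"
    by (intro tendsto_intros) auto
  moreover have "eventually (\<lambda>r. f r / (1 / 2 ^ r)
      = 1 / (1 - real ((2 * h r) choose (h r)) / 4 ^ h r)) at_top"
    using assms(1) by eventually_elim simp
  ultimately show "(\<lambda>r. f r / (1 / 2 ^ r)) \<longlonglongrightarrow> 1"
    by (simp only: tendsto_cong diff_zero div_by_1)
qed

lemma filterlim_pow2_pred: "filterlim (\<lambda>r. 2 ^ (r - 1) :: nat) at_top at_top"
proof (rule filterlim_at_top_mono)
  show "filterlim (\<lambda>r :: nat. r - 1) at_top at_top"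
    by (rule filterlim_minus_const_nat_at_top)
  show "eventually (\<lambda>r :: nat. r - 1 \<le> 2 ^ (r - 1)) at_top"
    by (simp add: less_imp_le)
qed

section \<open>Efficacy of the lifted Hamming codes\<close>

theorem theorem4p12:
  fixes M :: "nat \<Rightarrow> bit mat"
  assumes "\<And>r. r \<ge> 2 \<Longrightarrow> hamming_check_matrix r (M r)"
  shows "(\<forall>r\<ge>2.
            graphical_design (cube_verts (2 ^ r)) (cube_adj (2 ^ r)) (2 ^ r)
              (lifted_code 1 (M r)) \<and>
            graphical_design (cube_verts (2 ^ r + 1)) (cube_adj (2 ^ r + 1)) (2 ^ r + 1)
              (lifted_code 2 (M r)) \<and>
            efficacy (cube_verts (2 ^ r)) (cube_adj (2 ^ r)) (lifted_code 1 (M r))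
              = 2 ^ (2 ^ r - r) / (2 ^ (2 ^ r) - real ((2 ^ r) choose (2 ^ (r - 1)))) \<and>
            efficacy (cube_verts (2 ^ r + 1)) (cube_adj (2 ^ r + 1)) (lifted_code 2 (M r))
              = 2 ^ (2 ^ r - r + 1)
                  / (2 ^ (2 ^ r + 1) - real ((2 ^ r + 1) choose (2 ^ (r - 1))))) \<and>
         (\<lambda>r. efficacy (cube_verts (2 ^ r)) (cube_adj (2 ^ r)) (lifted_code 1 (M r)))
           \<sim>[at_top] (\<lambda>r. 1 / 2 ^ r) \<and>
         (\<lambda>r. efficacy (cube_verts (2 ^ r + 1)) (cube_adj (2 ^ r + 1)) (lifted_code 2 (M r)))
           \<sim>[at_top] (\<lambda>r. 1 / 2 ^ r)"
proof (intro conjI allI impI)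
  fix r :: nat
  assume r: "r \<ge> 2"
  note M = assms[OF r]
  have "r \<le> 2 ^ r"
    by (simp add: less_imp_le)
  then have pow: "(2 :: real) ^ (2 ^ r) / 2 ^ r = 2 ^ (2 ^ r - r)"
      "(2 :: real) ^ (2 ^ r + 1) / 2 ^ r = 2 ^ (2 ^ r - r + 1)"
    by (simp_all add: power_diff)
  show "graphical_design (cube_verts (2 ^ r)) (cube_adj (2 ^ r)) (2 ^ r) (lifted_code 1 (M r))"
    by (rule hamming_lift_one_design[OF r M])
  show "graphical_design (cube_verts (2 ^ r + 1)) (cube_adj (2 ^ r + 1)) (2 ^ r + 1)
      (lifted_code 2 (M r))"
    by (rule hamming_lift_two_design[OF r M])
  show "efficacy (cube_verts (2 ^ r)) (cube_adj (2 ^ r)) (lifted_code 1 (M r))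
      = 2 ^ (2 ^ r - r) / (2 ^ (2 ^ r) - real ((2 ^ r) choose (2 ^ (r - 1))))"
    unfolding hamming_lift_one_efficacy[OF r M] pow ..
  show "efficacy (cube_verts (2 ^ r + 1)) (cube_adj (2 ^ r + 1)) (lifted_code 2 (M r))
      = 2 ^ (2 ^ r - r + 1) / (2 ^ (2 ^ r + 1) - real ((2 ^ r + 1) choose (2 ^ (r - 1))))"
    unfolding hamming_lift_two_efficacy[OF r M] pow ..
next
  have density: "2 ^ n / a / (2 ^ n - b) = 1 / a / (1 - b / 2 ^ n)" for a b :: real and n :: nat
    by (simp add: field_simps)
  have two_pow: "(2 :: nat) ^ r = 2 * 2 ^ (r - 1)" if "r \<ge> 2" for r
    using that by (simp flip: power_Suc)
  show "(\<lambda>r. efficacy (cube_verts (2 ^ r)) (cube_adj (2 ^ r)) (lifted_code 1 (M r)))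
      \<sim>[at_top] (\<lambda>r. 1 / 2 ^ r)"
  proof (rule asymp_equiv_central_density[OF _ filterlim_pow2_pred])
    show "eventually (\<lambda>r. efficacy (cube_verts (2 ^ r)) (cube_adj (2 ^ r)) (lifted_code 1 (M r))
      = 1 / 2 ^ r / (1 - real ((2 * 2 ^ (r - 1)) choose (2 ^ (r - 1))) / 4 ^ (2 ^ (r - 1)))) at_top"
      using eventually_ge_at_top[of 2]
    proof eventually_elim
      case (elim r)
      have eq: "(2 :: real) ^ (2 ^ r) = 4 ^ (2 ^ (r - 1))"
        unfolding two_pow[OF elim] power_mult by simp
      show ?case
        unfolding hamming_lift_one_efficacy[OF elim assms[OF elim]] density
        unfolding eq unfolding two_pow[OF elim] ..
    qed
  qed
  show "(\<lambda>r. efficacy (cube_verts (2 ^ r + 1)) (cube_adj (2 ^ r + 1)) (lifted_code 2 (M r)))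
      \<sim>[at_top] (\<lambda>r. 1 / 2 ^ r)"
  proof (rule asymp_equiv_central_density)
    \<comment> \<open>In dimension \<open>2 * k + 1\<close> the density is the central one of index \<open>Suc k\<close>.\<close>
    show "filterlim (\<lambda>r. Suc (2 ^ (r - 1))) at_top at_top"
      by (rule filterlim_compose[OF filterlim_Suc filterlim_pow2_pred])
    show "eventually (\<lambda>r. efficacy (cube_verts (2 ^ r + 1)) (cube_adj (2 ^ r + 1))
        (lifted_code 2 (M r))
      = 1 / 2 ^ r / (1 - real ((2 * Suc (2 ^ (r - 1))) choose (Suc (2 ^ (r - 1))))
          / 4 ^ Suc (2 ^ (r - 1)))) at_top"
      using eventually_ge_at_top[of 2]
    proof eventually_elim
      case (elim r)
      define k :: nat where "k = 2 ^ (r - 1)"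
      have n: "(2 :: nat) ^ r + 1 = Suc (2 * k)"
        unfolding two_pow[OF elim] k_def by (rule Suc_eq_plus1[symmetric])
      have eq: "real (Suc (2 * k) choose k) / 2 ^ Suc (2 * k)
          = real ((2 * Suc k) choose (Suc k)) / 4 ^ Suc k"
        unfolding central_binomial_eq_double by (simp del: binomial_Suc_Suc add: power_mult)
      show ?case
        unfolding hamming_lift_two_efficacy[OF elim assms[OF elim]] density
        unfolding k_def[symmetric] n eq ..
    qed
  qed
qed

end
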